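(* Let $\mathbf h_{\mathrm c},\mathbf h_{\mathrm s}\in\mathbb C^N$ be linearly independent with $\mathbf h_{\mathrm s}^{\mathrm H}\mathbf h_{\mathrm c}\neq0$, let $\mathbf f_{\mathrm s}\in\mathbb C^M\setminus\{0\}$, and let $P,\alpha,\sigma_{\mathrm s},\sigma_{\mathrm c},\Gamma_{\mathrm{sen}}>0$. Consider $$\max_{\mathbf w\in\mathbb C^N,\ \|\mathbf w\|^2=P}\ \log_2\!\Big(1+\frac{|\mathbf h_{\mathrm c}^{\mathrm H}\mathbf w|^2}{\sigma_{\mathrm c}^2}\Big)\quad\text{s.t.}\quad\frac{\alpha\|\mathbf f_{\mathrm s}\|^2\,|\mathbf h_{\mathrm s}^{\mathrm H}\mathbf w|^2}{\sigma_{\mathrm s}^2}\ge\Gamma_{\mathrm{sen}},$$ and assume the problem is feasible. Define $$\Gamma_P=\frac{\Gamma_{\mathrm{sen}}\|\mathbf h_{\mathrm c}\|^2\sigma_{\mathrm s}^2}{\alpha\|\mathbf f_{\mathrm s}\|^2|\mathbf h_{\mathrm s}^{\mathrm H}\mathbf h_{\mathrm c}|^2},\quad \hat{\mathbf h}_{\mathrm s}=\frac{\mathbf h_{\mathrm s}}{\|\mathbf h_{\mathrm s}\|},\quad \hat{\mathbf h}_{\mathrm c\bot\mathrm s}=\frac{\mathbf h_{\mathrm c}-(\hat{\mathbf h}_{\mathrm s}^{\mathrm H}\mathbf h_{\mathrm c})\hat{\mathbf h}_{\mathrm s}}{\|\mathbf h_{\mathrm c}-(\hat{\mathbf h}_{\mathrm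 s}^{\mathrm H}\mathbf h_{\mathrm c})\hat{\mathbf h}_{\mathrm s}\|},$$ $$c_1=\sqrt{\frac{\Gamma_{\mathrm{sen}}\sigma_{\mathrm s}^2}{\alpha\|\mathbf f_{\mathrm s}\|^2\|\mathbf h_{\mathrm s}\|^2}}\;\frac{\hat{\mathbf h}_{\mathrm s}^{\mathrm H}\mathbf h_{\mathrm c}}{|\hat{\mathbf h}_{\mathrm s}^{\mathrm H}\mathbf h_{\mathrm c}|},\qquad c_2=\sqrt{P-\frac{\Gamma_{\mathrm{sen}}\sigma_{\mathrm s}^2}{\alpha\|\mathbf f_{\mathrm s}\|^2\|\mathbf h_{\mathrm s}\|^2}}\;\frac{\hat{\mathbf h}_{\mathrm c\bot\mathrm s}^{\mathrm H}\mathbf h_{\mathrm c}}{|\hat{\mathbf h}_{\mathrm c\bot\mathrm s}^{\mathrm H}\mathbf h_{\mathrm c}|}.$$ Then an optimal solution is $$\mathbf w_{\mathrm t}^\star=\begin{cases}\sqrt P\,\mathbf h_{\mathrm c}/\|\mathbf h_{\mathrm c}\|,&\text{if }P>\Gamma_P,\\ c_1\hat{\mathbf h}_{\mathrm s}+c_2\hat{\mathbf h}_{\mathrm c\bot\mathrm s},&\text{otherwise.}\end{cases}$$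
   Context: For given antenna positions, $\mathbf h_{\mathrm c}$ and $\mathbf h_{\mathrm s}$ are the transmit channel vectors to the communication user and to the sensing target, and $\mathbf f_{\mathrm s}$ is the echo channel vector from the target to the receiver. Maximum-ratio combining is used at the receiver, so the sensing SNR is $\alpha\|\mathbf f_{\mathrm s}\|^2|\mathbf h_{\mathrm s}^{\mathrm H}\mathbf w|^2/\sigma_{\mathrm s}^2$. The transmit power $P$ is absorbed into the beamformer $\mathbf w$. *)

theory Defs
  imports "HOL-Analysis.Analysis"
begin

text \<open>The product \<open>x\<^sup>H y\<close>, conjugate-linear in the first argument. The
  library's \<open>inner\<close> on \<open>complex ^ 'n\<close> is only its real part.\<close>

definition hprod :: "complex ^ 'n \<Rightarrow> complex ^ 'n \<Rightarrow> complex" where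
  "hprod x y = (\<Sum>i\<in>UNIV. cnj (x $ i) * y $ i)"

definition comm_rate :: "complex ^ 'n \<Rightarrow> real \<Rightarrow> complex ^ 'n \<Rightarrow> real" where
  "comm_rate h\<^sub>c \<sigma>\<^sub>c w = log 2 (1 + (cmod (hprod h\<^sub>c w))\<^sup>2 / \<sigma>\<^sub>c\<^sup>2)"

definition sensing_snr ::
  "real \<Rightarrow> complex ^ 'm \<Rightarrow> complex ^ 'n \<Rightarrow> real \<Rightarrow> complex ^ 'n \<Rightarrow> real" where
  "sensing_snr \<alpha> f\<^sub>s h\<^sub>s \<sigma>\<^sub>s w =
     \<alpha> * (norm f\<^sub>s)\<^sup>2 * (cmod (hprod h\<^sub>s w))\<^sup>2 / \<sigma>\<^sub>s\<^sup>2"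

definition feasible ::
  "real \<Rightarrow> complex ^ 'm \<Rightarrow> complex ^ 'n \<Rightarrow> real \<Rightarrow> real \<Rightarrow> real \<Rightarrow> complex ^ 'n \<Rightarrow> bool" where
  "feasible \<alpha> f\<^sub>s h\<^sub>s \<sigma>\<^sub>s \<Gamma> P w \<longleftrightarrow>
     (norm w)\<^sup>2 = P \<and> sensing_snr \<alpha> f\<^sub>s h\<^sub>s \<sigma>\<^sub>s w \<ge> \<Gamma>"

end

(* Expand everything in the orthonormal basis (h_hat, h_perp) of span {h_c, h_s}. Writing
   x = |h_hat^H w|, y = |h_perp^H w|, the constraints give x^2 + y^2 <= P (Bessel) and
   x >= sqrt t with t = Gamma sigma_s^2 / (alpha |f_s|^2 |h_s|^2), and the objective is at most
   |a| x + |b| y for h_c = a h_hat + b h_perp. Either the unconstrained Cauchy-Schwarz maximiser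
   satisfies x >= sqrt t, or the optimum sits at the corner (sqrt t, sqrt (P - t)); the given
   w_star aligns the phases so that the triangle inequality is attained. *)
theory Submission
  imports Defs
begin

lemma hprod_add_right: "hprod x (y + z) = hprod x y + hprod x z"
  by (simp add: hprod_def ring_distribs sum.distrib)

lemma hprod_add_left: "hprod (x + y) z = hprod x z + hprod y z"
  by (simp add: hprod_def ring_distribs sum.distrib)

lemma hprod_diff_right: "hprod x (y - z) = hprod x y - hprod x z"
  by (simp add: hprod_def ring_distribs sum_subtractf)

lemma hprod_scale_right: "hprod x (c *s y) = c * hprod x y"
  by (simp add: hprod_def sum_distrib_left mult_ac)

lemma hprod_scale_left: "hprod (c *s x) y = cnj c * hprod x y"
  by (simp add: hprod_def sum_distrib_left mult_ac)

lemma hprod_scaleR_right: "hprod x (r *\<^sub>R y) = of_real r * hprod x y"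
  by (simp add: hprod_def sum_distrib_left scaleR_conv_of_real[where 'a = complex] mult_ac)

lemma hprod_scaleR_left: "hprod (r *\<^sub>R x) y = of_real r * hprod x y"
  by (simp add: hprod_def sum_distrib_left scaleR_conv_of_real[where 'a = complex] mult_ac)

lemma cnj_hprod: "cnj (hprod x y) = hprod y x"
  by (simp add: hprod_def mult_ac)

text \<open>Bridge between the two structures: a norm identity becomes an identity of complex
  numbers, follows from sesquilinearity, and returns to the reals by injectivity of
  \<open>of_real\<close>.\<close>

lemma hprod_self: "hprod x x = of_real ((norm x)\<^sup>2)"
proof -
  have "(norm x)\<^sup>2 = (\<Sum>i\<in>UNIV. (cmod (x $ i))\<^sup>2)"
    by (simp add: norm_vec_def L2_set_def sum_nonneg)
  then show ?thesis
    by (simp only: hprod_def of_real_sum complex_norm_square mult.commute)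
qed

lemma norm_add_orthogonal:
  assumes "hprod x y = 0"
  shows "(norm (x + y))\<^sup>2 = (norm x)\<^sup>2 + (norm y)\<^sup>2"
proof -
  have "hprod y x = 0"
    using assms cnj_hprod[of x y] by simp
  then have "complex_of_real ((norm (x + y))\<^sup>2) = of_real ((norm x)\<^sup>2 + (norm y)\<^sup>2)"
    using assms
    by (simp add: hprod_self[symmetric] hprod_add_left hprod_add_right del: of_real_power)
  then show ?thesis
    by (simp only: of_real_eq_iff)
qed

lemma norm_scale: "norm (c *s x) = cmod c * norm x" for x :: "complex ^ 'n"
proof -
  have "complex_of_real ((norm (c *s x))\<^sup>2) = of_real ((cmod c * norm x)\<^sup>2)"
    unfolding hprod_self[symmetric] hprod_scale_left hprod_scale_right power_mult_distrib
    by (simp add: hprod_self complex_norm_square[of c, unfolded of_real_power] mult_ac)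
  then show ?thesis
    by (simp only: of_real_eq_iff power2_eq_iff_nonneg norm_ge_zero mult_nonneg_nonneg)
qed

lemma norm_combination_orthonormal:
  assumes "norm u = 1" "norm v = 1" "hprod u v = 0"
  shows "(norm (c *s u + d *s v))\<^sup>2 = (cmod c)\<^sup>2 + (cmod d)\<^sup>2"
  using assms by (simp add: norm_add_orthogonal hprod_scale_left hprod_scale_right norm_scale)

lemma bessel_hprod:
  assumes "norm u = 1" "norm v = 1" "hprod u v = 0"
  shows "(cmod (hprod u w))\<^sup>2 + (cmod (hprod v w))\<^sup>2 \<le> (norm w)\<^sup>2"
proof -
  \<comment> \<open>\<open>p\<close> is the orthogonal projection of \<open>w\<close> onto the span
    of \<open>u\<close> and \<open>v\<close>. Pythagoras splits off the residual
    \<open>w - p\<close>, whose squared norm is then dropped.\<close>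
  define p where "p = hprod u w *s u + hprod v w *s v"
  have "hprod v u = 0"
    using assms(3) cnj_hprod[of u v] by simp
  then have "hprod p (w - p) = 0"
    using assms by (simp add: p_def hprod_add_left hprod_scale_left hprod_diff_right
        hprod_add_right hprod_scale_right hprod_self[of u] hprod_self[of v])
  then have "(norm w)\<^sup>2 = (norm p)\<^sup>2 + (norm (w - p))\<^sup>2"
    using norm_add_orthogonal[of p "w - p"] by simp
  then show ?thesis
    using norm_combination_orthonormal[OF assms] by (simp add: p_def)
qed

text \<open>The projection of \<open>y\<close> onto the complex line through \<open>x\<close> has
  length \<open>cmod (hprod x y) / norm x\<close>, and by Pythagoras it is no longer than
  \<open>y\<close>.\<close>

lemma hprod_cauchy_schwarz: "cmod (hprod x y) \<le> norm x * norm y"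
proof (cases "x = 0")
  case True
  then show ?thesis by (simp add: hprod_def)
next
  case False
  define c where "c = hprod x y / of_real ((norm x)\<^sup>2)"
  have "hprod (c *s x) (y - c *s x) = 0"
    using False by (simp add: c_def hprod_scale_left hprod_diff_right hprod_scale_right hprod_self[of x])
  then have "(norm y)\<^sup>2 = (norm (c *s x))\<^sup>2 + (norm (y - c *s x))\<^sup>2"
    using norm_add_orthogonal[of "c *s x" "y - c *s x"] by simp
  then have "(norm (c *s x))\<^sup>2 \<le> (norm y)\<^sup>2"
    by simp
  then have "norm (c *s x) \<le> norm y"
    by (rule power2_le_imp_le) simp
  moreover have "norm (c *s x) = cmod (hprod x y) / norm x"
    using False by (simp add: norm_scale c_def norm_divide norm_mult power2_eq_square)
  ultimately show ?thesis
    using False by (simp add: divide_simps mult.commute)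
qed

text \<open>For \<open>r > 0\<close>, \<open>r (a x + b y) = b (s x + r y) - (b s - a r) x\<close>, where the first bracket is at
  most \<open>s\<^sup>2 + r\<^sup>2\<close> and the second is nonnegative.\<close>

lemma linear_max_at_corner:
  fixes a b s r x y :: real
  assumes "b \<ge> 0" "s > 0" "r \<ge> 0" "s \<le> x" "y \<ge> 0"
    and disc: "x\<^sup>2 + y\<^sup>2 \<le> s\<^sup>2 + r\<^sup>2" and slope: "a * r \<le> b * s"
  shows "a * x + b * y \<le> a * s + b * r"
proof (cases "r = 0")
  case True
  \<comment> \<open>Here the factor \<open>r\<close> cannot be cancelled, but the feasible region
    collapses to the single point \<open>(s, 0)\<close>.\<close>
  have "s\<^sup>2 \<le> x\<^sup>2"
    using assms by (intro power_mono) auto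
  moreover have "x\<^sup>2 + y\<^sup>2 \<le> s\<^sup>2"
    using disc True by simp
  ultimately have "x\<^sup>2 = s\<^sup>2" "y\<^sup>2 = 0"
    using zero_le_power2[of y] by linarith+
  then show ?thesis
    using True assms by (simp add: power2_eq_iff_nonneg)
next
  case False
  have "2 * (s * x + r * y) \<le> (s\<^sup>2 + x\<^sup>2) + (r\<^sup>2 + y\<^sup>2)"
    using sum_squares_bound[of s x] sum_squares_bound[of r y] by simp
  then have "b * (s * x + r * y) \<le> b * (s\<^sup>2 + r\<^sup>2)"
    using disc assms(1) by (intro mult_left_mono) auto
  moreover have "(b * s - a * r) * s \<le> (b * s - a * r) * x"
    using assms by (intro mult_left_mono) auto
  ultimately have "r * (a * x + b * y) \<le> r * (a * s + b * r)"
    by (simp add: algebra_simps power2_eq_square)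
  then show ?thesis
    using False \<open>r \<ge> 0\<close> by simp
qed

text \<open>Since the logarithm is monotone, only the gain \<open>cmod (hprod h w)\<close> has to be
  maximised.\<close>

lemma comm_rate_le:
  assumes "cmod (hprod h w) \<le> cmod (hprod h z)"
  shows "comm_rate h \<sigma> w \<le> comm_rate h \<sigma> z"
  unfolding comm_rate_def using assms
  by (subst log_le_cancel_iff) (auto intro!: divide_right_mono power_mono add_pos_nonneg)

text \<open>The phase alignment behind \<open>c1\<close> and \<open>c2\<close>: giving a coefficient
  the phase of \<open>z\<close> cancels the phase of \<open>cnj z\<close>, so that for nonnegative
  \<open>r\<close> both contributions to the gain are nonnegative reals and add without
  loss.\<close>

lemma cnj_mult_phase: "cnj z * (of_real r * (z / of_real (cmod z))) = of_real (cmod z * r)"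
  using complex_norm_square[of z]
  by (cases "z = 0") (simp_all add: field_simps power2_eq_square)

theorem lemma2:
  fixes h\<^sub>c h\<^sub>s h_hat h_perp w_star :: "complex ^ 'n"
    and f\<^sub>s :: "complex ^ 'm"
    and P \<alpha> \<sigma>\<^sub>s \<sigma>\<^sub>c \<Gamma> \<Gamma>\<^sub>P :: real
    and c1 c2 :: complex
  assumes lin_indep: "h\<^sub>c \<noteq> h\<^sub>s" "vec.independent {h\<^sub>c, h\<^sub>s}"
    and "hprod h\<^sub>s h\<^sub>c \<noteq> 0"
    and "f\<^sub>s \<noteq> 0"
    and "P > 0" "\<alpha> > 0" "\<sigma>\<^sub>s > 0" "\<sigma>\<^sub>c > 0" "\<Gamma> > 0"
    and feasible: "\<exists>w. feasible \<alpha> f\<^sub>s h\<^sub>s \<sigma>\<^sub>s \<Gamma> P w"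
    and Gamma_P: "\<Gamma>\<^sub>P = \<Gamma> * (norm h\<^sub>c)\<^sup>2 * \<sigma>\<^sub>s\<^sup>2 / (\<alpha> * (norm f\<^sub>s)\<^sup>2 * (cmod (hprod h\<^sub>s h\<^sub>c))\<^sup>2)"
    and h_hat: "h_hat = h\<^sub>s /\<^sub>R norm h\<^sub>s"
    and h_perp: "h_perp = (h\<^sub>c - hprod h_hat h\<^sub>c *s h_hat) /\<^sub>R norm (h\<^sub>c - hprod h_hat h\<^sub>c *s h_hat)"
    and c1: "c1 = complex_of_real (sqrt (\<Gamma> * \<sigma>\<^sub>s\<^sup>2 / (\<alpha> * (norm f\<^sub>s)\<^sup>2 * (norm h\<^sub>s)\<^sup>2)))
                  * (hprod h_hat h\<^sub>c / complex_of_real (cmod (hprod h_hat h\<^sub>c)))"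
    and c2: "c2 = complex_of_real (sqrt (P - \<Gamma> * \<sigma>\<^sub>s\<^sup>2 / (\<alpha> * (norm f\<^sub>s)\<^sup>2 * (norm h\<^sub>s)\<^sup>2)))
                  * (hprod h_perp h\<^sub>c / complex_of_real (cmod (hprod h_perp h\<^sub>c)))"
    and w_star: "w_star = (if P > \<Gamma>\<^sub>P then sqrt P *\<^sub>R (h\<^sub>c /\<^sub>R norm h\<^sub>c)
                           else c1 *s h_hat + c2 *s h_perp)"
  shows "is_arg_max (comm_rate h\<^sub>c \<sigma>\<^sub>c) (feasible \<alpha> f\<^sub>s h\<^sub>s \<sigma>\<^sub>s \<Gamma> P) w_star"
proof -
  \<comment> \<open>\<open>t\<close> is the least power along \<open>h_hat\<close> that satisfies
    the sensing constraint; \<open>a\<close> and \<open>b\<close> are the coordinates of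
    \<open>h\<^sub>c\<close> in the orthonormal pair.\<close>
  define t where "t = \<Gamma> * \<sigma>\<^sub>s\<^sup>2 / (\<alpha> * (norm f\<^sub>s)\<^sup>2 * (norm h\<^sub>s)\<^sup>2)"
  define a where "a = hprod h_hat h\<^sub>c"
  define b where "b = hprod h_perp h\<^sub>c"
  define e where "e = h\<^sub>c - a *s h_hat"
  have hs0: "h\<^sub>s \<noteq> 0" and hc0: "h\<^sub>c \<noteq> 0"
    using lin_indep(2) vec.dependent_zero by auto
  have hs: "h\<^sub>s = norm h\<^sub>s *\<^sub>R h_hat"
    using hs0 by (simp add: h_hat)
  have u1: "norm h_hat = 1"
    using hs0 by (simp add: h_hat)
  have hprod_hs: "cmod (hprod h\<^sub>s w) = norm h\<^sub>s * cmod (hprod h_hat w)" for w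
    by (subst hs) (simp add: hprod_scaleR_left norm_mult)
  have a0: "a \<noteq> 0"
    using \<open>hprod h\<^sub>s h\<^sub>c \<noteq> 0\<close> hprod_hs[of h\<^sub>c] by (auto simp: a_def)
  have e0: "e \<noteq> 0"
  proof
    assume "e = 0"
    then have "h\<^sub>c = (a / of_real (norm h\<^sub>s)) *s h\<^sub>s"
      using hs0 by (simp add: e_def h_hat vec_eq_iff scaleR_conv_of_real[where 'a = complex] divide_inverse mult_ac)
    \<comment> \<open>Because \<open>h\<^sub>c \<noteq> h\<^sub>s\<close>, removing
      \<open>h\<^sub>c\<close> leaves \<open>h\<^sub>s\<close> in the set, and a multiple of it
      contradicts independence.\<close>
    then have "h\<^sub>c \<in> vec.span ({h\<^sub>c, h\<^sub>s} - {h\<^sub>c})"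
      using lin_indep(1) vec.span_scale[OF vec.span_base, of h\<^sub>s "{h\<^sub>s}"]
      by (simp add: insert_Diff_if)
    then show False
      using lin_indep(2) by (auto simp: vec.dependent_def)
  qed
  have v: "h_perp = e /\<^sub>R norm e"
    by (simp add: h_perp e_def a_def)
  have v1: "norm h_perp = 1"
    using e0 by (simp add: v)
  have e_perp: "e = norm e *\<^sub>R h_perp"
    using e0 by (simp add: v)
  have ue: "hprod h_hat e = 0"
    using u1 by (simp add: e_def hprod_diff_right hprod_scale_right hprod_self a_def)
  then have uv: "hprod h_hat h_perp = 0"
    by (simp add: v hprod_scaleR_right)
  then have vu: "hprod h_perp h_hat = 0"
    using cnj_hprod[of h_hat h_perp] by simp
  have hc_e: "h\<^sub>c = a *s h_hat + e"
    by (simp add: e_def)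
  \<comment> \<open>\<open>h_perp\<close> is the normalised residual of \<open>h\<^sub>c\<close>
    itself, so \<open>b\<close> is real and positive and the phase factor in \<open>c2\<close>
    equals 1.\<close>
  have b_eq: "b = of_real (norm e)"
    unfolding b_def
    by (subst hc_e, subst e_perp)
       (simp add: hprod_add_right hprod_scale_right hprod_scaleR_right vu hprod_self v1)
  then have b0: "b \<noteq> 0"
    using e0 by simp
  have hc: "h\<^sub>c = a *s h_hat + b *s h_perp"
    by (subst hc_e, subst e_perp)
       (simp add: b_eq vec_eq_iff scaleR_conv_of_real[where 'a = complex])
  have norm_hc: "(norm h\<^sub>c)\<^sup>2 = (cmod a)\<^sup>2 + (cmod b)\<^sup>2"
    by (subst hc) (rule norm_combination_orthonormal[OF u1 v1 uv])
  have hprod_hc: "hprod h\<^sub>c w = cnj a * hprod h_hat w + cnj b * hprod h_perp w" for w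
    by (subst hc) (simp add: hprod_add_left hprod_scale_left)

  have t0: "t > 0"
    using assms hs0 by (simp add: t_def)
  have feas: "feasible \<alpha> f\<^sub>s h\<^sub>s \<sigma>\<^sub>s \<Gamma> P w \<longleftrightarrow> (norm w)\<^sup>2 = P \<and> t \<le> (cmod (hprod h_hat w))\<^sup>2" for w
    using \<open>f\<^sub>s \<noteq> 0\<close> \<open>\<alpha> > 0\<close> \<open>\<sigma>\<^sub>s > 0\<close> hs0
    by (simp add: feasible_def sensing_snr_def hprod_hs t_def power_mult_distrib field_simps)
  have bessel: "(cmod (hprod h_hat w))\<^sup>2 + (cmod (hprod h_perp w))\<^sup>2 \<le> (norm w)\<^sup>2" for w
    using bessel_hprod[OF u1 v1 uv] .
  obtain w0 where "(norm w0)\<^sup>2 = P" "t \<le> (cmod (hprod h_hat w0))\<^sup>2"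
    using feasible feas by blast
  \<comment> \<open>Feasibility enters here: it makes the radicand \<open>P - t\<close> in
    \<open>c2\<close> nonnegative.\<close>
  then have tP: "t \<le> P"
    using bessel[of w0] zero_le_power2[of "cmod (hprod h_perp w0)"] by linarith
  have Gamma_P': "\<Gamma>\<^sub>P = t * (norm h\<^sub>c)\<^sup>2 / (cmod a)\<^sup>2"
    using hprod_hs[of h\<^sub>c] hs0 by (simp add: Gamma_P t_def a_def power_mult_distrib field_simps)

  have "feasible \<alpha> f\<^sub>s h\<^sub>s \<sigma>\<^sub>s \<Gamma> P w_star \<and>
    (\<forall>w. feasible \<alpha> f\<^sub>s h\<^sub>s \<sigma>\<^sub>s \<Gamma> P w \<longrightarrow> cmod (hprod h\<^sub>c w) \<le> cmod (hprod h\<^sub>c w_star))"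
  proof (cases "P > \<Gamma>\<^sub>P")
    case True
    then have w: "w_star = (sqrt P / norm h\<^sub>c) *\<^sub>R h\<^sub>c"
      by (simp add: w_star divide_inverse)
    have "(norm w_star)\<^sup>2 = P"
      using hc0 \<open>P > 0\<close> by (simp add: w)
    moreover have "(cmod (hprod h_hat w_star))\<^sup>2 = P * (cmod a)\<^sup>2 / (norm h\<^sub>c)\<^sup>2"
      using \<open>P > 0\<close>
      by (simp add: w hprod_scaleR_right a_def norm_mult power_mult_distrib norm_divide power_divide)
    \<comment> \<open>The case condition says that the Cauchy-Schwarz maximiser over the whole
      sphere meets the sensing constraint with room to spare.\<close>
    moreover have "t \<le> P * (cmod a)\<^sup>2 / (norm h\<^sub>c)\<^sup>2"
      using True a0 hc0 by (simp add: Gamma_P' field_simps)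
    moreover have "cmod (hprod h\<^sub>c w_star) = norm h\<^sub>c * sqrt P"
      using hc0 \<open>P > 0\<close>
      by (simp add: w hprod_scaleR_right hprod_self norm_mult norm_divide norm_power power2_eq_square)
    moreover have "cmod (hprod h\<^sub>c w) \<le> norm h\<^sub>c * sqrt P" if "(norm w)\<^sup>2 = P" for w
      using hprod_cauchy_schwarz[of h\<^sub>c w] by (simp flip: that)
    ultimately show ?thesis
      by (simp add: feas)
  next
    case False
    then have w: "w_star = c1 *s h_hat + c2 *s h_perp"
      by (simp add: w_star)
    define s where "s = sqrt t"
    define r where "r = sqrt (P - t)"
    have s0: "s > 0" and r0: "r \<ge> 0" and s2: "s\<^sup>2 = t" and r2: "r\<^sup>2 = P - t"
      using t0 tP by (simp_all add: s_def r_def)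
    have c1': "c1 = of_real s * (a / of_real (cmod a))"
      and c2': "c2 = of_real r * (b / of_real (cmod b))"
      by (simp_all add: c1 c2 s_def r_def t_def a_def b_def)
    have norm_c: "cmod c1 = s" "cmod c2 = r"
      using a0 b0 s0 r0 by (simp_all add: c1' c2' norm_mult norm_divide)
    have uw: "hprod h_hat w_star = c1" and vw: "hprod h_perp w_star = c2"
      by (simp_all add: w hprod_add_right hprod_scale_right hprod_self u1 v1 uv vu)
    have "(norm w_star)\<^sup>2 = P"
      using norm_combination_orthonormal[OF u1 v1 uv, of c1 c2] by (simp add: w norm_c s2 r2)
    moreover have "t \<le> (cmod (hprod h_hat w_star))\<^sup>2"
      by (simp add: uw norm_c s2)
    moreover have "cmod (hprod h\<^sub>c w_star) = cmod a * s + cmod b * r"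
    proof -
      have "hprod h\<^sub>c w_star = of_real (cmod a * s + cmod b * r)"
        unfolding hprod_hc uw vw c1' c2' cnj_mult_phase by simp
      then show ?thesis
        using s0 r0 by (simp only: norm_of_real) simp
    qed
    moreover have "cmod (hprod h\<^sub>c w) \<le> cmod a * s + cmod b * r"
      if "(norm w)\<^sup>2 = P" "t \<le> (cmod (hprod h_hat w))\<^sup>2" for w
    proof -
      \<comment> \<open>\<open>h\<^sub>c\<close> lies in the span of the pair, so the gain sees only
        two coordinates of \<open>w\<close>; what remains is a linear problem over a piece of a real
        disc.\<close>
      have "cmod (hprod h\<^sub>c w) \<le> cmod a * cmod (hprod h_hat w) + cmod b * cmod (hprod h_perp w)"
        unfolding hprod_hc by (rule norm_triangle_le) (simp add: norm_mult)
      also have "\<dots> \<le> cmod a * s + cmod b * r"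
      proof (rule linear_max_at_corner)
        show "s \<le> cmod (hprod h_hat w)"
          using that(2) by (simp add: s_def real_le_lsqrt)
        show "(cmod (hprod h_hat w))\<^sup>2 + (cmod (hprod h_perp w))\<^sup>2 \<le> s\<^sup>2 + r\<^sup>2"
          using bessel[of w] that(1) by (simp add: s2 r2)
        \<comment> \<open>Splitting \<open>(norm h\<^sub>c)\<^sup>2\<close> by Pythagoras turns the
          failed case condition into
          \<open>(cmod a)\<^sup>2 * (P - t) \<le> (cmod b)\<^sup>2 * t\<close>: the objective
          direction is at least as steep as the corner \<open>(s, r)\<close>, so spending more than
          \<open>t\<close> along \<open>h_hat\<close> does not pay.\<close>
        have "P * (cmod a)\<^sup>2 \<le> t * (norm h\<^sub>c)\<^sup>2"
          using False a0 by (simp add: Gamma_P' field_simps)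
        then have "(cmod a * r)\<^sup>2 \<le> (cmod b * s)\<^sup>2"
          by (simp add: power_mult_distrib s2 r2 norm_hc algebra_simps)
        then show "cmod a * r \<le> cmod b * s"
          by (rule power2_le_imp_le) (use s0 in simp)
      qed (use s0 r0 in auto)
      finally show ?thesis .
    qed
    ultimately show ?thesis
      by (simp add: feas)
  qed
  then show ?thesis
    by (auto simp: is_arg_max_def not_less intro: comm_rate_le)
qed

end
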